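(* $B_1$ is algebraically closed, in the sense that for every $n\geq 1$ each quotient of the free $B_1$-algebra $B_1[x_1,\dots,x_n]$ by a maximal congruence is isomorphic to $B_1$; and, for every $n\geq 1$, the set $\mathrm{MaxSpec}(B_1[x_1,\dots,x_n])$ of maximal congruences on $B_1[x_1,\dots,x_n]$ has cardinality $2^n$.
   Context: $B_1=\{0,1\}$ with addition $0+0=0$, $0+1=1+0=1+1=1$ and the usual multiplication. A $B_1$-module is a commutative monoid $(M,+)$ with neutral element $0$ and an external law $B_1\times M\to M$ satisfying $(\lambda+\mu)x=\lambda x+\mu x$, $\lambda(x+y)=\lambda x+\lambda y$, $1x=x$, $0x=0$ (equivalently, a commutative monoid with $x+x=x$ for all $x$). A (commutative, unital) $B_1$-algebra is a $B_1$-module $\mathcal{A}$ containing $B_1$ (so $0\neq 1$) with an associative, commutative multiplication with neutral element $1$, bilinear for the $B_1$-module operations (in particular $0\cdot a=0$); morphisms preserve $+,\cdot,0,1$. $B_1[x_1,\dots,x_n]$ denotes the free $B_1$-algebra on $x_1,\dots,x_n$; its elements are the finite (possibly empty) formal sums of distinct monomials in $x_1,\dots,x_n$, i.e. finite subsets of $\mathbf{N}^n$, with addition $\cup$ and multiplication $RS=\{a+b: a\in R,b\in S\}$. A congruence on a $B_1$-algebra $\mathcal{A}$ is an equivalence relation $\sim$ on $\mathcal{A}$ with $0\nsim 1$ and such that $a\sim b$, $a'\sim b'$ imply $a+a'\sim b+b'$ and $aa'\sim bb'$; then $\mathcal{A}/\sim$ is a $B_1$-algebra. Congruences are ordered by $\sim_1\geq\sim_2$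 iff ($a\sim_2 b\Rightarrow a\sim_1 b$ for all $a,b$), and a maximal congruence is a maximal element for this order. *)

theory Defs
  imports "HOL-Algebra.Ring"
begin

text \<open>
  Over \<open>B\<^sub>1 = {0, 1}\<close> (with \<open>1 + 1 = 1\<close>) the scalar multiplication of a module is forced by
  \<open>0x = 0\<close> and \<open>1x = x\<close>, and the module laws amount to \<open>x + x = x\<close>; see
  \<open>b1_module_iff_idempotent\<close> below. Hence \<open>B\<^sub>1\<close>-algebras are carried by the ring
  record, without a field for the scalar multiplication.
\<close>

locale b1_algebra = semiring A + comm_monoid A for A (structure) +
  assumes add_idem: "x \<in> carrier A \<Longrightarrow> x \<oplus> x = x"
    and zero_neq_one: "\<zero> \<noteq> \<one>"

definition B1 :: "bool ring" where
  "B1 = \<lparr>carrier = UNIV, mult = (\<and>), one = True, zero = False, add = (\<or>)\<rparr>"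

text \<open>
  The free algebra on \<open>x\<^sub>0, \<dots>, x\<^sub>n\<^sub>-\<^sub>1\<close>: an element is the finite set of the exponent vectors
  of its monomials. A vector in \<open>\<nat>\<^sup>n\<close> is a function on \<open>nat\<close> that is zero from \<open>n\<close> on, so
  that distinct functions are distinct monomials.
\<close>

definition exponents :: "nat \<Rightarrow> (nat \<Rightarrow> nat) set" where
  "exponents n = {a. \<forall>i\<ge>n. a i = 0}"

definition B1_poly :: "nat \<Rightarrow> (nat \<Rightarrow> nat) set ring" where
  "B1_poly n =
    \<lparr>carrier = {R. finite R \<and> R \<subseteq> exponents n},
     mult = (\<lambda>R S. {\<lambda>i. a i + b i | a b. a \<in> R \<and> b \<in> S}),
     one = {\<lambda>i. 0},
     zero = {},
     add = (\<union>)\<rparr>"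

text \<open>\<open>ring_hom\<close> does not require that \<open>\<zero>\<close> be preserved.\<close>

definition b1_hom :: "('a, 'm) ring_scheme \<Rightarrow> ('b, 'k) ring_scheme \<Rightarrow> ('a \<Rightarrow> 'b) set" where
  "b1_hom A B = {h \<in> ring_hom A B. h \<zero>\<^bsub>A\<^esub> = \<zero>\<^bsub>B\<^esub>}"

definition b1_isomorphic :: "('a, 'm) ring_scheme \<Rightarrow> ('b, 'k) ring_scheme \<Rightarrow> bool" where
  "b1_isomorphic A B \<longleftrightarrow> (\<exists>h \<in> b1_hom A B. bij_betw h (carrier A) (carrier B))"

definition b1_congruence :: "('a, 'm) ring_scheme \<Rightarrow> ('a \<times> 'a) set \<Rightarrow> bool" where
  "b1_congruence A r \<longleftrightarrow>
     equiv (carrier A) r \<and> (\<zero>\<^bsub>A\<^esub>, \<one>\<^bsub>A\<^esub>) \<notin> r \<and>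
     (\<forall>a b a' b'. (a, b) \<in> r \<longrightarrow> (a', b') \<in> r \<longrightarrow>
        (a \<oplus>\<^bsub>A\<^esub> a', b \<oplus>\<^bsub>A\<^esub> b') \<in> r \<and> (a \<otimes>\<^bsub>A\<^esub> a', b \<otimes>\<^bsub>A\<^esub> b') \<in> r)"

definition MaxSpec :: "('a, 'm) ring_scheme \<Rightarrow> ('a \<times> 'a) set set" where
  "MaxSpec A =
     {r. b1_congruence A r \<and> (\<forall>s. b1_congruence A s \<longrightarrow> r \<subseteq> s \<longrightarrow> s = r)}"

definition b1_quotient :: "('a, 'm) ring_scheme \<Rightarrow> ('a \<times> 'a) set \<Rightarrow> 'a set ring" where
  "b1_quotient A r =
    \<lparr>carrier = carrier A // r,
     mult = (\<lambda>X Y. \<Union>x\<in>X. \<Union>y\<in>Y. r `` {x \<otimes>\<^bsub>A\<^esub> y}),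
     one = r `` {\<one>\<^bsub>A\<^esub>},
     zero = r `` {\<zero>\<^bsub>A\<^esub>},
     add = (\<lambda>X Y. \<Union>x\<in>X. \<Union>y\<in>Y. r `` {x \<oplus>\<^bsub>A\<^esub> y})\<rparr>"

lemma (in abelian_monoid) b1_module_iff_idempotent:
  "(\<exists>s :: bool \<Rightarrow> 'a \<Rightarrow> 'a.
      (\<forall>c. \<forall>x\<in>carrier G. s c x \<in> carrier G) \<and>
      (\<forall>c d. \<forall>x\<in>carrier G. s (c \<oplus>\<^bsub>B1\<^esub> d) x = s c x \<oplus> s d x) \<and>
      (\<forall>c. \<forall>x\<in>carrier G. \<forall>y\<in>carrier G. s c (x \<oplus> y) = s c x \<oplus> s c y) \<and>
      (\<forall>x\<in>carrier G. s \<one>\<^bsub>B1\<^esub> x = x) \<and> (\<forall>x\<in>carrier G. s \<zero>\<^bsub>B1\<^esub> x = \<zero>))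
   \<longleftrightarrow> (\<forall>x\<in>carrier G. x \<oplus> x = x)" (is "?L \<longleftrightarrow> ?R")
proof
  assume ?L
  then obtain s :: "bool \<Rightarrow> 'a \<Rightarrow> 'a"
    where s: "\<forall>c d. \<forall>x\<in>carrier G. s (c \<or> d) x = s c x \<oplus> s d x"
      "\<forall>x\<in>carrier G. s True x = x"
    by (auto simp: B1_def)
  show ?R
    using s(2) s(1)[rule_format, of _ True True] by auto
next
  assume ?R
  then show ?L
    by (intro exI[of _ "\<lambda>c x. if c then x else \<zero>"]) (auto simp: B1_def)
qed

lemma b1_algebra_B1: "b1_algebra B1"
  by unfold_locales (auto simp: B1_def Units_def)

lemma b1_algebra_B1_poly: "b1_algebra (B1_poly n)"
proof -
  define P :: "(nat \<Rightarrow> nat) set \<Rightarrow> (nat \<Rightarrow> nat) set \<Rightarrow> (nat \<Rightarrow> nat) set"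
    where "P = (\<lambda>R S. {\<lambda>i. a i + b i | a b. a \<in> R \<and> b \<in> S})"
  have mult: "mult (B1_poly n) = P"
    by (simp add: B1_poly_def P_def)
  have fin: "finite (P R S)" if "finite R" "finite S" for R S
    unfolding P_def
    using finite_image_set2[of "\<lambda>a. a \<in> R" "\<lambda>b. b \<in> S" "\<lambda>a b i. a i + b i"] that by simp
  have closed: "P R S \<subseteq> exponents n" if "R \<subseteq> exponents n" "S \<subseteq> exponents n" for R S
    using that by (auto simp: P_def exponents_def)
  have assoc: "P (P R S) T = P R (P S T)" for R S T
  proof -
    have "P (P R S) T = {\<lambda>i. a i + b i + c i | a b c. a \<in> R \<and> b \<in> S \<and> c \<in> T}"
      unfolding P_def by (safe; fastforce)
    also have "\<dots> = {\<lambda>i. a i + (b i + c i) | a b c. a \<in> R \<and> b \<in> S \<and> c \<in> T}"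
      by (simp add: add.assoc)
    also have "\<dots> = P R (P S T)"
      unfolding P_def by (safe; fastforce)
    finally show ?thesis .
  qed
  have comm: "P R S = P S R" for R S
    unfolding P_def by (subst add.commute) blast
  have unit: "P {\<lambda>i. 0} R = R" for R
    by (simp add: P_def)
  show ?thesis
    unfolding b1_algebra_def semiring_def abelian_monoid_def
  proof (intro conjI)
    show "comm_monoid (add_monoid (B1_poly n))"
      by (rule comm_monoidI) (auto simp: B1_poly_def)
    show cm: "comm_monoid (B1_poly n)"
    proof (rule comm_monoidI, unfold mult)
      show "P R S = P S R" for R S by (rule comm)
      show "P (P R S) T = P R (P S T)" for R S T by (rule assoc)
    qed (use fin closed unit in \<open>auto simp: B1_poly_def exponents_def\<close>)
    show "Group.monoid (B1_poly n)"
      using cm by (rule comm_monoid.axioms(1))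
    show "semiring_axioms (B1_poly n)"
      by unfold_locales (auto simp: B1_poly_def)
    show "b1_algebra_axioms (B1_poly n)"
      by unfold_locales (auto simp: B1_poly_def)
  qed
qed

lemma b1_algebra_quotient:
  assumes "b1_algebra A" and r: "b1_congruence A r"
  shows "b1_algebra (b1_quotient A r)"
proof -
  interpret b1_algebra A by fact
  have eq: "equiv (carrier A) r" and ne: "(\<zero>\<^bsub>A\<^esub>, \<one>\<^bsub>A\<^esub>) \<notin> r"
    using r by (auto simp: b1_congruence_def)
  have op: "(\<Union>x\<in>r `` {a}. \<Union>y\<in>r `` {b}. r `` {f x y}) = r `` {f a b}"
    if "a \<in> carrier A" "b \<in> carrier A" "f = add A \<or> f = mult A" for a b f
  proof -
    have "r `` {f x y} = r `` {f a b}" if "x \<in> r `` {a}" "y \<in> r `` {b}" for x y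
    proof -
      have "(f a b, f x y) \<in> r"
        using r that \<open>f = add A \<or> f = mult A\<close> by (auto simp: b1_congruence_def)
      then show ?thesis using equiv_class_eq[OF eq] by metis
    qed
    moreover have "a \<in> r `` {a}" "b \<in> r `` {b}"
      using that equiv_class_self[OF eq] by blast+
    ultimately show ?thesis by blast
  qed
  have add: "r `` {a} \<oplus>\<^bsub>b1_quotient A r\<^esub> r `` {b} = r `` {a \<oplus>\<^bsub>A\<^esub> b}"
    and mult: "r `` {a} \<otimes>\<^bsub>b1_quotient A r\<^esub> r `` {b} = r `` {a \<otimes>\<^bsub>A\<^esub> b}"
    if "a \<in> carrier A" "b \<in> carrier A" for a b
    using that op by (auto simp: b1_quotient_def)
  have carr: "carrier (b1_quotient A r) = (\<lambda>a. r `` {a}) ` carrier A"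
    and one: "\<one>\<^bsub>b1_quotient A r\<^esub> = r `` {\<one>\<^bsub>A\<^esub>}"
    and zero: "\<zero>\<^bsub>b1_quotient A r\<^esub> = r `` {\<zero>\<^bsub>A\<^esub>}"
    by (auto simp: b1_quotient_def quotient_def)
  show ?thesis
    unfolding b1_algebra_def semiring_def abelian_monoid_def
  proof (intro conjI)
    show "comm_monoid (add_monoid (b1_quotient A r))"
      by (rule comm_monoidI) (auto simp: carr zero add a_ac)
    show cm: "comm_monoid (b1_quotient A r)"
      by (rule comm_monoidI) (auto simp: carr one mult m_ac)
    show "Group.monoid (b1_quotient A r)"
      using cm by (rule comm_monoid.axioms(1))
    show "semiring_axioms (b1_quotient A r)"
      by unfold_locales (auto simp: carr zero add mult l_distr r_distr)
    show "b1_algebra_axioms (b1_quotient A r)"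
    proof
      show "\<zero>\<^bsub>b1_quotient A r\<^esub> \<noteq> \<one>\<^bsub>b1_quotient A r\<^esub>"
        using ne eq_equiv_class[OF _ eq] by (auto simp: zero one)
    qed (auto simp: carr add add_idem)
  qed
qed

end

theory Submission
  imports Defs
begin

text \<open>
  A homomorphism to \<open>B\<^sub>1\<close> is the same as a prime ideal that is closed under passing to smaller
  elements in the order \<open>x \<le> y \<longleftrightarrow> x + y = y\<close>. A maximal proper such ideal exists by Zorn's lemma
  and is prime: if \<open>1 \<le> m + ca\<close> and \<open>1 \<le> m' + db\<close>, then \<open>1\<close> is below the product, which lies in
  the ideal as soon as \<open>m\<close>, \<open>m'\<close> and \<open>ab\<close> do. Applied to a quotient, this places every congruence
  inside the kernel of a homomorphism to \<open>B\<^sub>1\<close>. Such a kernel has only two classes, so it is maximal.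
  Hence maximal congruences are exactly these kernels, and on the free algebra a homomorphism to
  \<open>B\<^sub>1\<close> is determined by the set of variables that it sends to \<open>1\<close>.
\<close>

section \<open>Homomorphisms to \<open>B1\<close> and their kernels\<close>

definition b1_kernel :: "('a, 'm) ring_scheme \<Rightarrow> ('a \<Rightarrow> bool) \<Rightarrow> ('a \<times> 'a) set" where
  "b1_kernel A h = {(x, y). x \<in> carrier A \<and> y \<in> carrier A \<and> h x = h y}"

lemma b1_hom_B1_iff:
  "h \<in> b1_hom A B1 \<longleftrightarrow>
     (\<forall>x\<in>carrier A. \<forall>y\<in>carrier A. h (x \<oplus>\<^bsub>A\<^esub> y) = (h x \<or> h y)) \<and>
     (\<forall>x\<in>carrier A. \<forall>y\<in>carrier A. h (x \<otimes>\<^bsub>A\<^esub> y) = (h x \<and> h y)) \<and>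
     h \<one>\<^bsub>A\<^esub> \<and> \<not> h \<zero>\<^bsub>A\<^esub>"
  by (auto simp: b1_hom_def ring_hom_def B1_def)

text \<open>The last clause is downward closure: in an idempotent commutative monoid the elements
  above \<open>x\<close> are exactly the sums \<open>x \<oplus> y\<close>. The zero set of a
  homomorphism to \<open>B1\<close> has all these properties.\<close>

definition hereditary_ideal :: "('a, 'm) ring_scheme \<Rightarrow> 'a set \<Rightarrow> bool" where
  "hereditary_ideal A I \<longleftrightarrow>
     I \<subseteq> carrier A \<and> \<zero>\<^bsub>A\<^esub> \<in> I \<and>
     (\<forall>x\<in>I. \<forall>y\<in>I. x \<oplus>\<^bsub>A\<^esub> y \<in> I) \<and>
     (\<forall>c\<in>carrier A. \<forall>x\<in>I. c \<otimes>\<^bsub>A\<^esub> x \<in> I) \<and>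
     (\<forall>x\<in>carrier A. \<forall>y\<in>carrier A. x \<oplus>\<^bsub>A\<^esub> y \<in> I \<longrightarrow> x \<in> I)"

section \<open>Maximal hereditary ideals and the homomorphisms they define\<close>

context b1_algebra
begin

lemma add_idem_left: "x \<in> carrier A \<Longrightarrow> y \<in> carrier A \<Longrightarrow> x \<oplus> (x \<oplus> y) = x \<oplus> y"
  by (metis a_assoc add_idem)

text \<open>If \<open>x \<oplus> y = \<zero>\<close>, then
  \<open>x = x \<oplus> (x \<oplus> y) = x \<oplus> y = \<zero>\<close>. This ideal makes the family
  in Zorn's lemma nonempty.\<close>

lemma hereditary_ideal_zero: "hereditary_ideal A {\<zero>}"
  unfolding hereditary_ideal_def
proof (intro conjI ballI impI)
  fix x y assume "x \<in> carrier A" "y \<in> carrier A" "x \<oplus> y \<in> {\<zero>}"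
  then show "x \<in> {\<zero>}"
    by (metis add_idem_left r_zero singleton_iff)
qed auto

text \<open>\<open>J\<close> is the downward closure of the ideal generated by \<open>M\<close> and
  \<open>a\<close>: its elements are those below some \<open>m \<oplus> c \<otimes> a\<close>. Upper
  bounds can be added and multiplied by scalars, and they pass to smaller elements.\<close>

lemma hereditary_ideal_adjoin:
  assumes M: "hereditary_ideal A M" and a: "a \<in> carrier A"
  defines "J \<equiv> {y \<in> carrier A. \<exists>m\<in>M. \<exists>c\<in>carrier A. y \<oplus> (m \<oplus> c \<otimes> a) = m \<oplus> c \<otimes> a}"
  shows "hereditary_ideal A J" "M \<subseteq> J" "a \<in> J"
proof -
  have MC: "\<And>m. m \<in> M \<Longrightarrow> m \<in> carrier A" and M0: "\<zero> \<in> M"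
    using M by (auto simp: hereditary_ideal_def)
  show "M \<subseteq> J"
  proof
    fix m assume "m \<in> M"
    \<comment> \<open>An element \<open>m\<close> of \<open>M\<close> is below itself, with
      coefficient \<open>\<zero>\<close> on \<open>a\<close>.\<close>
    moreover from this have "m \<in> carrier A" "m \<oplus> (m \<oplus> \<zero> \<otimes> a) = m \<oplus> \<zero> \<otimes> a"
      using MC a by (simp_all add: add_idem)
    ultimately show "m \<in> J"
      unfolding J_def by blast
  qed
  \<comment> \<open>The bound for \<open>a\<close> is \<open>a\<close> itself, with
    \<open>\<zero>\<close> from \<open>M\<close> and coefficient \<open>\<one>\<close>.\<close>
  have "a \<oplus> (\<zero> \<oplus> \<one> \<otimes> a) = \<zero> \<oplus> \<one> \<otimes> a"
    using a by (simp add: add_idem)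
  then show "a \<in> J"
    unfolding J_def using M0 a by blast
  show "hereditary_ideal A J"
    unfolding hereditary_ideal_def
  proof (intro conjI ballI impI)
    show "J \<subseteq> carrier A" by (auto simp: J_def)
    show "\<zero> \<in> J" using M0 \<open>M \<subseteq> J\<close> by blast
  next
    fix x y assume "x \<in> J" "y \<in> J"
    then obtain m c m' c' where *: "x \<in> carrier A" "y \<in> carrier A" "m \<in> M" "m' \<in> M"
      "c \<in> carrier A" "c' \<in> carrier A"
      and eqs: "x \<oplus> (m \<oplus> c \<otimes> a) = m \<oplus> c \<otimes> a" "y \<oplus> (m' \<oplus> c' \<otimes> a) = m' \<oplus> c' \<otimes> a"
      unfolding J_def by blast
    have "m \<oplus> m' \<in> M"
      using M * by (auto simp: hereditary_ideal_def)
    have "(m \<oplus> m') \<oplus> (c \<oplus> c') \<otimes> a = (m \<oplus> c \<otimes> a) \<oplus> (m' \<oplus> c' \<otimes> a)"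
      using * a MC by (simp add: l_distr a_ac)
    moreover have "(x \<oplus> y) \<oplus> ((m \<oplus> c \<otimes> a) \<oplus> (m' \<oplus> c' \<otimes> a))
        = (x \<oplus> (m \<oplus> c \<otimes> a)) \<oplus> (y \<oplus> (m' \<oplus> c' \<otimes> a))"
      using * a MC by (simp add: a_ac)
    ultimately have "(x \<oplus> y) \<oplus> ((m \<oplus> m') \<oplus> (c \<oplus> c') \<otimes> a) = (m \<oplus> m') \<oplus> (c \<oplus> c') \<otimes> a"
      using eqs by simp
    then show "x \<oplus> y \<in> J"
      unfolding J_def using * \<open>m \<oplus> m' \<in> M\<close> by blast
  next
    fix d x assume d: "d \<in> carrier A" and "x \<in> J"
    then obtain m c where *: "x \<in> carrier A" "m \<in> M" "c \<in> carrier A"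
      "x \<oplus> (m \<oplus> c \<otimes> a) = m \<oplus> c \<otimes> a"
      unfolding J_def by blast
    have "d \<otimes> m \<in> M"
      using M * d by (auto simp: hereditary_ideal_def)
    have "d \<otimes> m \<oplus> (d \<otimes> c) \<otimes> a = d \<otimes> (m \<oplus> c \<otimes> a)"
      using * d a MC by (simp add: r_distr m_assoc)
    moreover have "d \<otimes> x \<oplus> d \<otimes> (m \<oplus> c \<otimes> a) = d \<otimes> (m \<oplus> c \<otimes> a)"
      by (subst r_distr[symmetric]) (use * d a MC in simp_all)
    ultimately have "d \<otimes> x \<oplus> (d \<otimes> m \<oplus> (d \<otimes> c) \<otimes> a) = d \<otimes> m \<oplus> (d \<otimes> c) \<otimes> a"
      using * by simp
    then show "d \<otimes> x \<in> J"
      unfolding J_def using * d \<open>d \<otimes> m \<in> M\<close> by blast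
  next
    fix x y assume xy: "x \<in> carrier A" "y \<in> carrier A" and "x \<oplus> y \<in> J"
    then obtain m c where *: "m \<in> M" "c \<in> carrier A"
      "(x \<oplus> y) \<oplus> (m \<oplus> c \<otimes> a) = m \<oplus> c \<otimes> a"
      unfolding J_def by blast
    \<comment> \<open>Transitivity of the order: \<open>x\<close> is below
      \<open>x \<oplus> y\<close>, which is below \<open>m \<oplus> c \<otimes> a\<close>.\<close>
    then have "x \<oplus> (m \<oplus> c \<otimes> a) = m \<oplus> c \<otimes> a"
      using xy a MC
      by (metis a_assoc add_idem_left a_closed m_closed)
    then show "x \<in> J"
      unfolding J_def using * xy by blast
  qed
qed

text \<open>Zorn's lemma, with the union as upper bound of a nonempty chain. Closure under sums uses
  that two elements of the union lie in a common member; \<open>\<one>\<close> is in no member,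
  hence not in the union.\<close>

lemma exists_maximal_hereditary_ideal:
  obtains M where "hereditary_ideal A M" "\<one> \<notin> M"
    "\<And>J. hereditary_ideal A J \<Longrightarrow> \<one> \<notin> J \<Longrightarrow> M \<subseteq> J \<Longrightarrow> J = M"
proof -
  let ?F = "{I. hereditary_ideal A I \<and> \<one> \<notin> I}"
  have "\<exists>M\<in>?F. \<forall>X\<in>?F. M \<subseteq> X \<longrightarrow> X = M"
  proof (rule subset_Zorn_nonempty)
    show "?F \<noteq> {}"
      using hereditary_ideal_zero zero_neq_one by auto
  next
    fix C assume "C \<noteq> {}" and chain: "subset.chain ?F C"
    then have C: "\<And>I. I \<in> C \<Longrightarrow> hereditary_ideal A I \<and> \<one> \<notin> I"
      and total: "\<And>I J. I \<in> C \<Longrightarrow> J \<in> C \<Longrightarrow> I \<subseteq> J \<or> J \<subseteq> I"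
      by (auto simp: subset.chain_def)
    have "hereditary_ideal A (\<Union>C)"
      unfolding hereditary_ideal_def
    proof (intro conjI ballI impI)
      show "\<Union>C \<subseteq> carrier A" "\<zero> \<in> \<Union>C"
        using C \<open>C \<noteq> {}\<close> unfolding hereditary_ideal_def by blast+
    next
      fix x y assume "x \<in> \<Union>C" "y \<in> \<Union>C"
      then obtain I where "I \<in> C" "x \<in> I" "y \<in> I"
        using total by blast
      then show "x \<oplus> y \<in> \<Union>C"
        using C unfolding hereditary_ideal_def by blast
    next
      fix c x assume "c \<in> carrier A" "x \<in> \<Union>C"
      then show "c \<otimes> x \<in> \<Union>C"
        using C unfolding hereditary_ideal_def by blast
    next
      fix x y assume "x \<in> carrier A" "y \<in> carrier A" "x \<oplus> y \<in> \<Union>C"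
      then show "x \<in> \<Union>C"
        using C unfolding hereditary_ideal_def by blast
    qed
    then show "\<Union>C \<in> ?F"
      using C by blast
  qed
  then show thesis
    using that by blast
qed

text \<open>The homomorphism is the indicator of the complement of a maximal \<open>M\<close>. Sums
  are respected because \<open>M\<close> is closed under sums and hereditary, products because
  \<open>M\<close> is an ideal and prime.\<close>

lemma exists_hom_B1: "\<exists>h. h \<in> b1_hom A B1"
proof -
  obtain M where M: "hereditary_ideal A M" and one: "\<one> \<notin> M"
    and max: "\<And>J. hereditary_ideal A J \<Longrightarrow> \<one> \<notin> J \<Longrightarrow> M \<subseteq> J \<Longrightarrow> J = M"
    using exists_maximal_hereditary_ideal by metis
  have MC: "\<And>x. x \<in> M \<Longrightarrow> x \<in> carrier A"
    and Madd: "\<And>x y. x \<in> M \<Longrightarrow> y \<in> M \<Longrightarrow> x \<oplus> y \<in> M"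
    and Mmult: "\<And>c x. c \<in> carrier A \<Longrightarrow> x \<in> M \<Longrightarrow> c \<otimes> x \<in> M"
    and Mher: "\<And>x y. x \<in> carrier A \<Longrightarrow> y \<in> carrier A \<Longrightarrow> x \<oplus> y \<in> M \<Longrightarrow> x \<in> M"
    using M unfolding hereditary_ideal_def by blast+
  \<comment> \<open>Adjoining \<open>a\<close> gives a strictly larger hereditary ideal, which by
    maximality contains \<open>\<one>\<close>.\<close>
  have unit: "\<exists>m\<in>M. \<exists>c\<in>carrier A. \<one> \<oplus> (m \<oplus> c \<otimes> a) = m \<oplus> c \<otimes> a"
    if "a \<in> carrier A" "a \<notin> M" for a
    using hereditary_ideal_adjoin[OF M that(1)] max that(2) by blast
  have prime: "a \<in> M \<or> b \<in> M"
    if ab: "a \<in> carrier A" "b \<in> carrier A" "a \<otimes> b \<in> M" for a b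
  proof (rule ccontr)
    assume "\<not> (a \<in> M \<or> b \<in> M)"
    then obtain m c m' d where *: "m \<in> M" "c \<in> carrier A" "m' \<in> M" "d \<in> carrier A"
      and u: "\<one> \<oplus> (m \<oplus> c \<otimes> a) = m \<oplus> c \<otimes> a"
      and v: "\<one> \<oplus> (m' \<oplus> d \<otimes> b) = m' \<oplus> d \<otimes> b"
      using unit ab by meson
    define u where "u = m \<oplus> c \<otimes> a"
    define v where "v = m' \<oplus> d \<otimes> b"
    have uv: "u \<in> carrier A" "v \<in> carrier A" "\<one> \<oplus> u = u" "\<one> \<oplus> v = v"
      using * ab MC u v by (auto simp: u_def v_def)
    \<comment> \<open>The product is expanded so that each summand is a multiple of
      \<open>m\<close>, \<open>m'\<close> or \<open>a \<otimes> b\<close>, all of which lie in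
      \<open>M\<close>.\<close>
    have "u \<otimes> v = v \<otimes> m \<oplus> ((c \<otimes> a) \<otimes> m' \<oplus> (c \<otimes> d) \<otimes> (a \<otimes> b))"
    proof -
      have "u \<otimes> v = m \<otimes> v \<oplus> (c \<otimes> a) \<otimes> v"
        unfolding u_def using * ab MC uv by (simp add: l_distr)
      also have "(c \<otimes> a) \<otimes> v = (c \<otimes> a) \<otimes> m' \<oplus> (c \<otimes> a) \<otimes> (d \<otimes> b)"
        unfolding v_def using * ab MC by (simp add: r_distr)
      also have "(c \<otimes> a) \<otimes> (d \<otimes> b) = (c \<otimes> d) \<otimes> (a \<otimes> b)"
        using * ab by (simp add: m_ac)
      also have "m \<otimes> v = v \<otimes> m"
        using * MC uv by (simp add: m_comm)
      finally show ?thesis .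
    qed
    then have "u \<otimes> v \<in> M"
      using * ab MC uv by (auto intro!: Madd Mmult)
    moreover have "\<one> \<oplus> u \<otimes> v = u \<otimes> v"
    proof -
      \<comment> \<open>Absorbing \<open>\<one>\<close> first into \<open>u\<close> and then into
        \<open>v\<close> exhibits \<open>\<one>\<close> as a summand of
        \<open>u \<otimes> v\<close>.\<close>
      have "u \<otimes> v = (\<one> \<oplus> u) \<otimes> v"
        using uv by simp
      also have "\<dots> = (\<one> \<oplus> v) \<oplus> u \<otimes> v"
        using uv(1,2,4) by (simp add: l_distr)
      also have "\<dots> = \<one> \<oplus> (v \<oplus> u \<otimes> v)"
        using uv(1,2) by (simp add: a_assoc)
      finally have "u \<otimes> v = \<one> \<oplus> (v \<oplus> u \<otimes> v)" .
      then show ?thesis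
        using uv(1,2) by (metis add_idem_left a_closed m_closed one_closed)
    qed
    ultimately show False
      using Mher[of \<one> "u \<otimes> v"] one uv by simp
  qed
  have "(\<lambda>x. x \<notin> M) \<in> b1_hom A B1"
    unfolding b1_hom_B1_iff
  proof (intro conjI ballI)
    fix x y assume xy: "x \<in> carrier A" "y \<in> carrier A"
    have "y \<in> M" if "x \<oplus> y \<in> M"
      by (rule Mher[of y x]) (use xy that in \<open>simp_all add: a_comm\<close>)
    then show "(x \<oplus> y \<notin> M) = (x \<notin> M \<or> y \<notin> M)"
      using Madd[of x y] Mher[OF xy] by blast
    have "x \<otimes> y \<in> M" if "x \<in> M"
      unfolding m_comm[OF xy] using xy(2) that by (rule Mmult)
    then show "(x \<otimes> y \<notin> M) = (x \<notin> M \<and> y \<notin> M)"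
      using prime[OF xy] Mmult[OF xy(1), of y] by blast
  next
    show "\<one> \<notin> M" "\<not> \<zero> \<notin> M"
      using one M unfolding hereditary_ideal_def by blast+
  qed
  then show ?thesis by blast
qed

section \<open>Maximal congruences as kernels\<close>

lemma b1_congruence_b1_kernel:
  assumes "h \<in> b1_hom A B1"
  shows "b1_congruence A (b1_kernel A h)"
  unfolding b1_congruence_def
proof (intro conjI)
  show "equiv (carrier A) (b1_kernel A h)"
    by (rule equivI) (auto simp: b1_kernel_def refl_on_def sym_def trans_def)
qed (use assms in \<open>auto simp: b1_kernel_def b1_hom_B1_iff\<close>)

text \<open>Compatibility of \<open>r\<close> with both operations makes the unions that define the
  quotient operations range over constant families, so any representatives may be used.\<close>

lemma b1_quotient_class:
  assumes r: "b1_congruence A r"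
  shows "carrier (b1_quotient A r) = (\<lambda>a. r `` {a}) ` carrier A"
    and "\<one>\<^bsub>b1_quotient A r\<^esub> = r `` {\<one>}" "\<zero>\<^bsub>b1_quotient A r\<^esub> = r `` {\<zero>}"
    and "a \<in> carrier A \<Longrightarrow> b \<in> carrier A \<Longrightarrow>
      r `` {a} \<oplus>\<^bsub>b1_quotient A r\<^esub> r `` {b} = r `` {a \<oplus> b}"
    and "a \<in> carrier A \<Longrightarrow> b \<in> carrier A \<Longrightarrow>
      r `` {a} \<otimes>\<^bsub>b1_quotient A r\<^esub> r `` {b} = r `` {a \<otimes> b}"
proof -
  have eq: "equiv (carrier A) r"
    using r by (simp add: b1_congruence_def)
  have op: "(\<Union>x\<in>r `` {a}. \<Union>y\<in>r `` {b}. r `` {f x y}) = r `` {f a b}"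
    if "a \<in> carrier A" "b \<in> carrier A" "f = add A \<or> f = mult A" for a b f
  proof (rule UN_equiv_class2[OF eq eq])
    show "congruent2 r r (\<lambda>x y. r `` {f x y})"
      using r that(3)
      by (intro congruent2I') (auto simp: b1_congruence_def intro!: equiv_class_eq[OF eq])
  qed (use that in auto)
  show "carrier (b1_quotient A r) = (\<lambda>a. r `` {a}) ` carrier A"
    "\<one>\<^bsub>b1_quotient A r\<^esub> = r `` {\<one>}" "\<zero>\<^bsub>b1_quotient A r\<^esub> = r `` {\<zero>}"
    by (auto simp: b1_quotient_def quotient_def)
  show "a \<in> carrier A \<Longrightarrow> b \<in> carrier A \<Longrightarrow>
      r `` {a} \<oplus>\<^bsub>b1_quotient A r\<^esub> r `` {b} = r `` {a \<oplus> b}"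
    "a \<in> carrier A \<Longrightarrow> b \<in> carrier A \<Longrightarrow>
      r `` {a} \<otimes>\<^bsub>b1_quotient A r\<^esub> r `` {b} = r `` {a \<otimes> b}"
    using op by (simp_all add: b1_quotient_def)
qed

text \<open>The quotient is again a \<open>b1_algebra\<close>, so it has a homomorphism
  \<open>k\<close> to \<open>B1\<close>. Composing \<open>k\<close> with the class map gives a
  homomorphism on \<open>A\<close> that cannot separate elements related by
  \<open>r\<close>.\<close>

lemma b1_congruence_subset_b1_kernel:
  assumes r: "b1_congruence A r"
  shows "\<exists>h\<in>b1_hom A B1. r \<subseteq> b1_kernel A h"
proof -
  let ?Q = "b1_quotient A r"
  have eq: "equiv (carrier A) r"
    using r by (simp add: b1_congruence_def)
  interpret Q: b1_algebra ?Q
    by (rule b1_algebra_quotient[OF b1_algebra_axioms r])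
  obtain k where k: "k \<in> b1_hom ?Q B1"
    using Q.exists_hom_B1 by blast
  note Q = b1_quotient_class[OF r]
  have "(\<lambda>x. k (r `` {x})) \<in> b1_hom A B1"
    using k unfolding b1_hom_B1_iff Q(1) by (simp add: Q)
  moreover have "r \<subseteq> b1_kernel A (\<lambda>x. k (r `` {x}))"
    using eq equiv_class_eq[OF eq] by (fastforce simp: b1_kernel_def equiv_def refl_on_def)
  ultimately show ?thesis by blast
qed

text \<open>The two classes of the kernel are those of \<open>\<zero>\<close> and
  \<open>\<one>\<close>. An additional pair in \<open>s\<close> joins them, which a congruence
  forbids.\<close>

lemma b1_kernel_maximal:
  assumes h: "h \<in> b1_hom A B1" and s: "b1_congruence A s" and sub: "b1_kernel A h \<subseteq> s"
  shows "s = b1_kernel A h"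
proof (rule ccontr)
  assume "s \<noteq> b1_kernel A h"
  then obtain x y where xy: "(x, y) \<in> s" "(x, y) \<notin> b1_kernel A h"
    using sub by auto
  have s': "sym s" "trans s" "s \<subseteq> carrier A \<times> carrier A" "(\<zero>, \<one>) \<notin> s"
    using s by (auto simp: b1_congruence_def equiv_def)
  \<comment> \<open>The chain is \<open>\<zero>\<close>, \<open>y\<close>, \<open>x\<close>,
    \<open>\<one>\<close>: its outer links come from the kernel, the middle one from the given pair.
    The other orientation of a pair is reduced to this one by symmetry of \<open>s\<close>.\<close>
  have collapse: "(\<zero>, \<one>) \<in> s" if "(x, y) \<in> s" "h x" "\<not> h y" for x y
  proof -
    have "(\<zero>, y) \<in> b1_kernel A h" "(x, \<one>) \<in> b1_kernel A h"
      using h s'(3) that by (auto simp: b1_kernel_def b1_hom_B1_iff)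
    then have "(\<zero>, y) \<in> s" "(x, \<one>) \<in> s"
      using sub by blast+
    moreover have "(y, x) \<in> s"
      using s'(1) that(1) by (rule symD)
    ultimately show ?thesis
      using s'(2) by (meson transD)
  qed
  have "(y, x) \<in> s"
    using s'(1) xy(1) by (rule symD)
  moreover have "h x \<noteq> h y"
    using xy s'(3) by (auto simp: b1_kernel_def)
  ultimately show False
    using collapse[of x y] collapse[of y x] xy(1) s'(4) by blast
qed

theorem MaxSpec_eq_b1_kernels: "MaxSpec A = b1_kernel A ` b1_hom A B1"
proof (intro equalityI subsetI)
  fix r assume "r \<in> MaxSpec A"
  then have r: "b1_congruence A r" and max: "\<And>s. b1_congruence A s \<Longrightarrow> r \<subseteq> s \<Longrightarrow> s = r"
    by (auto simp: MaxSpec_def)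
  obtain h where h: "h \<in> b1_hom A B1" "r \<subseteq> b1_kernel A h"
    using b1_congruence_subset_b1_kernel[OF r] by blast
  then have "b1_kernel A h = r"
    by (intro max b1_congruence_b1_kernel)
  then show "r \<in> b1_kernel A ` b1_hom A B1"
    using h(1) by blast
next
  fix r assume "r \<in> b1_kernel A ` b1_hom A B1"
  then show "r \<in> MaxSpec A"
    unfolding MaxSpec_def using b1_congruence_b1_kernel b1_kernel_maximal by auto
qed

text \<open>Since \<open>h\<close> is constant on each class, the existential in \<open>?f\<close>
  reads off the common value without choosing a representative. Classes with equal values coincide,
  and \<open>\<zero>\<close> and \<open>\<one>\<close> give both values.\<close>

lemma b1_quotient_b1_kernel_isomorphic:
  assumes h: "h \<in> b1_hom A B1"
  shows "b1_isomorphic (b1_quotient A (b1_kernel A h)) B1"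
proof -
  let ?r = "b1_kernel A h" and ?f = "\<lambda>X. \<exists>x\<in>X. h x"
  have eq_class: "?r `` {a} = {x \<in> carrier A. h x = h a}" if "a \<in> carrier A" for a
    using that by (auto simp: b1_kernel_def)
  have f: "?f (?r `` {a}) = h a" if "a \<in> carrier A" for a
    using that by (auto simp: eq_class)
  note Q = b1_quotient_class[OF b1_congruence_b1_kernel[OF h]]
  have "?f \<in> b1_hom (b1_quotient A ?r) B1"
    using h unfolding b1_hom_B1_iff Q(1) ball_simps by (simp add: Q f del: Image_singleton_iff bex_simps)
  moreover have "inj_on ?f (carrier (b1_quotient A ?r))"
    unfolding Q(1) by (rule inj_onI) (auto simp: f eq_class)
  moreover have "?f ` carrier (b1_quotient A ?r) = UNIV"
  proof -
    have "h ` carrier A = UNIV"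
      unfolding UNIV_bool
      using h image_eqI[of True h \<one>] image_eqI[of False h \<zero>] by (auto simp: b1_hom_B1_iff)
    moreover have "?f ` carrier (b1_quotient A ?r) = h ` carrier A"
      unfolding Q(1) image_image by (rule image_cong) (simp_all only: f)
    ultimately show ?thesis by simp
  qed
  ultimately show ?thesis
    unfolding b1_isomorphic_def bij_betw_def by (auto simp: B1_def)
qed

end

section \<open>Homomorphisms from the free algebra to \<open>B1\<close>\<close>

text \<open>This is evaluation at the point of \<open>B1\<close> to the power \<open>n\<close> whose
  coordinate \<open>i\<close> is 1 exactly for \<open>i\<close> in \<open>S\<close>: a monomial
  takes the value 1 iff its support lies in \<open>S\<close>, and a sum iff one of its monomials
  does.\<close>

definition eval_indicator :: "nat \<Rightarrow> nat set \<Rightarrow> (nat \<Rightarrow> nat) set \<Rightarrow> bool" where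
  "eval_indicator n S R \<longleftrightarrow> (\<exists>a\<in>R. \<forall>i<n. a i \<noteq> 0 \<longrightarrow> i \<in> S)"

definition poly_var :: "nat \<Rightarrow> (nat \<Rightarrow> nat) set" where
  "poly_var i = {\<lambda>j. if j = i then 1 else 0}"

lemma poly_var_in_carrier: "i < n \<Longrightarrow> poly_var i \<in> carrier (B1_poly n)"
  by (auto simp: poly_var_def B1_poly_def exponents_def)

lemma eval_indicator_poly_var: "i < n \<Longrightarrow> eval_indicator n S (poly_var i) \<longleftrightarrow> i \<in> S"
  by (auto simp: eval_indicator_def poly_var_def)

text \<open>For products, natural exponents cannot cancel, so the support of a product of monomials
  is the union of the two supports; it lies in \<open>S\<close> iff both do.\<close>

lemma eval_indicator_hom: "eval_indicator n S \<in> b1_hom (B1_poly n) B1"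
  unfolding b1_hom_B1_iff
proof (intro conjI ballI)
  fix R T
  show "eval_indicator n S (R \<oplus>\<^bsub>B1_poly n\<^esub> T) = (eval_indicator n S R \<or> eval_indicator n S T)"
    by (simp add: eval_indicator_def B1_poly_def bex_Un)
  show "eval_indicator n S (R \<otimes>\<^bsub>B1_poly n\<^esub> T) = (eval_indicator n S R \<and> eval_indicator n S T)"
  proof
    assume "eval_indicator n S (R \<otimes>\<^bsub>B1_poly n\<^esub> T)"
    then obtain a b where "a \<in> R" "b \<in> T" "\<forall>i<n. a i + b i \<noteq> 0 \<longrightarrow> i \<in> S"
      by (auto simp: eval_indicator_def B1_poly_def)
    then show "eval_indicator n S R \<and> eval_indicator n S T"
      unfolding eval_indicator_def by (meson add_is_0)
  next
    assume "eval_indicator n S R \<and> eval_indicator n S T"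
    then obtain a b where ab: "a \<in> R" "b \<in> T" "\<forall>i<n. a i \<noteq> 0 \<longrightarrow> i \<in> S"
      "\<forall>i<n. b i \<noteq> 0 \<longrightarrow> i \<in> S"
      unfolding eval_indicator_def by blast
    then have "(\<lambda>i. a i + b i) \<in> R \<otimes>\<^bsub>B1_poly n\<^esub> T"
      by (auto simp: B1_poly_def)
    moreover have "\<forall>i<n. a i + b i \<noteq> 0 \<longrightarrow> i \<in> S"
      using ab by auto
    ultimately show "eval_indicator n S (R \<otimes>\<^bsub>B1_poly n\<^esub> T)"
      unfolding eval_indicator_def by (intro bexI)
  qed
qed (auto simp: eval_indicator_def B1_poly_def)

text \<open>Induction on the total degree, splitting off one variable at a time. Only the support of
  \<open>a\<close> matters, since multiplication in \<open>B1\<close> is idempotent.\<close>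

lemma hom_B1_poly_monomial:
  assumes h: "h \<in> b1_hom (B1_poly n) B1" and "a \<in> exponents n"
  shows "h {a} \<longleftrightarrow> (\<forall>i<n. a i \<noteq> 0 \<longrightarrow> h (poly_var i))"
  using assms(2)
proof (induction "\<Sum>i<n. a i" arbitrary: a rule: less_induct)
  case less
  show ?case
  proof (cases "\<exists>i<n. a i \<noteq> 0")
    case False
    \<comment> \<open>Membership in \<open>exponents n\<close> makes \<open>a\<close> vanish from
      \<open>n\<close> on as well.\<close>
    then have "a = (\<lambda>i. 0)"
      using less.prems unfolding exponents_def by (metis (mono_tags) mem_Collect_eq not_less)
    then have "{a} = \<one>\<^bsub>B1_poly n\<^esub>"
      by (simp add: B1_poly_def)
    then show ?thesis
      using h False by (simp add: b1_hom_B1_iff)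
  next
    case True
    then obtain i where i: "i < n" "a i \<noteq> 0" by blast
    define b where "b = a(i := a i - 1)"
    have b: "b \<in> exponents n"
      using less.prems i by (auto simp: b_def exponents_def)
    have "(\<Sum>j<n. b j) < (\<Sum>j<n. a j)"
      using i by (intro sum_strict_mono_ex1) (auto simp: b_def intro!: bexI[of _ i])
    note IH = less.hyps[OF this b]
    have "a = (\<lambda>j. (if j = i then 1 else 0) + b j)"
      using i by (auto simp: b_def)
    then have "{a} = poly_var i \<otimes>\<^bsub>B1_poly n\<^esub> {b}"
      by (simp add: B1_poly_def poly_var_def)
    moreover have "{b} \<in> carrier (B1_poly n)"
      using b by (simp add: B1_poly_def)
    ultimately have "h {a} \<longleftrightarrow> h (poly_var i) \<and> h {b}"
      using h poly_var_in_carrier[OF i(1)] by (simp add: b1_hom_B1_iff)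
    also have "\<dots> \<longleftrightarrow> (\<forall>j<n. a j \<noteq> 0 \<longrightarrow> h (poly_var j))"
      \<comment> \<open>The supports of \<open>a\<close> and \<open>b\<close> differ at most in
        \<open>i\<close>, and the condition at \<open>i\<close> is the separate conjunct
        \<open>h (poly_var i)\<close>.\<close>
      unfolding IH using i by (auto simp: b_def)
    finally show ?thesis .
  qed
qed

text \<open>A polynomial is the finite sum of its monomials, and \<open>h\<close> turns this sum
  into a disjunction; the empty sum is the zero element, with value \<open>False\<close>.\<close>

lemma hom_B1_poly_eq_eval_indicator:
  assumes h: "h \<in> b1_hom (B1_poly n) B1" and "R \<in> carrier (B1_poly n)"
  shows "h R = eval_indicator n {i. i < n \<and> h (poly_var i)} R"
proof -
  have "finite R" "R \<subseteq> exponents n"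
    using assms(2) by (auto simp: B1_poly_def)
  then have "h R \<longleftrightarrow> (\<exists>a\<in>R. h {a})"
  proof (induction R rule: finite_induct)
    case empty
    then show ?case
      using h by (simp add: b1_hom_B1_iff B1_poly_def)
  next
    case (insert a R)
    then have "{a} \<in> carrier (B1_poly n)" "R \<in> carrier (B1_poly n)"
      by (auto simp: B1_poly_def)
    then have "h ({a} \<oplus>\<^bsub>B1_poly n\<^esub> R) = (h {a} \<or> h R)"
      using h unfolding b1_hom_B1_iff by blast
    then show ?case
      using insert by (simp add: B1_poly_def)
  qed
  then show ?thesis
    using hom_B1_poly_monomial[OF h] \<open>R \<subseteq> exponents n\<close> by (auto simp: eval_indicator_def)
qed

section \<open>The maximal spectrum of the free algebra\<close>

lemma MaxSpec_B1_poly: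
  "MaxSpec (B1_poly n) = (\<lambda>S. b1_kernel (B1_poly n) (eval_indicator n S)) ` Pow {..<n}"
proof -
  interpret b1_algebra "B1_poly n" by (rule b1_algebra_B1_poly)
  show ?thesis
    unfolding MaxSpec_eq_b1_kernels
  proof (intro equalityI image_subsetI)
    fix h assume "h \<in> b1_hom (B1_poly n) B1"
    define S where "S = {i. i < n \<and> h (poly_var i)}"
    have "h R = eval_indicator n S R" if "R \<in> carrier (B1_poly n)" for R
      unfolding S_def using \<open>h \<in> b1_hom (B1_poly n) B1\<close> that by (rule hom_B1_poly_eq_eval_indicator)
    \<comment> \<open>The two functions are compared only on the carrier, which is all that the
      kernel depends on.\<close>
    then have "b1_kernel (B1_poly n) h = b1_kernel (B1_poly n) (eval_indicator n S)"
      by (auto simp: b1_kernel_def)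
    moreover have "S \<in> Pow {..<n}"
      by (auto simp: S_def)
    ultimately show "b1_kernel (B1_poly n) h \<in>
        (\<lambda>S. b1_kernel (B1_poly n) (eval_indicator n S)) ` Pow {..<n}"
      by (rule image_eqI)
  next
    fix S
    show "b1_kernel (B1_poly n) (eval_indicator n S)
        \<in> b1_kernel (B1_poly n) ` b1_hom (B1_poly n) B1"
      by (intro imageI eval_indicator_hom)
  qed
qed

text \<open>The set \<open>S\<close> can be recovered from its kernel: it consists of those
  \<open>i\<close> below \<open>n\<close> whose variable is congruent to 1. Distinct subsets of
  \<open>{..<n}\<close> therefore give distinct congruences.\<close>

lemma card_MaxSpec_B1_poly: "card (MaxSpec (B1_poly n)) = 2 ^ n"
proof -
  interpret b1_algebra "B1_poly n" by (rule b1_algebra_B1_poly)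
  let ?K = "\<lambda>S. b1_kernel (B1_poly n) (eval_indicator n S)"
  have mem: "i \<in> S \<longleftrightarrow> (poly_var i, \<one>\<^bsub>B1_poly n\<^esub>) \<in> ?K S" if "i < n" for i S
    using that eval_indicator_hom[of n S]
    by (simp add: b1_kernel_def poly_var_in_carrier eval_indicator_poly_var b1_hom_B1_iff)
  have "inj_on ?K (Pow {..<n})"
  proof (rule inj_onI)
    fix S T assume ST: "S \<in> Pow {..<n}" "T \<in> Pow {..<n}" and eq: "?K S = ?K T"
    have "i \<in> S \<longleftrightarrow> i \<in> T" if "i < n" for i
      unfolding mem[OF that, of S] mem[OF that, of T] eq ..
    then show "S = T"
      using ST by blast
  qed
  then show ?thesis
    by (simp add: MaxSpec_B1_poly card_image card_Pow)
qed

theorem mainTheorem5: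
  shows "(\<forall>n\<ge>1. \<forall>r\<in>MaxSpec (B1_poly n). b1_isomorphic (b1_quotient (B1_poly n) r) B1) \<and>
         (\<forall>n\<ge>1. card (MaxSpec (B1_poly n)) = 2 ^ n)"
proof (intro conjI allI impI ballI)
  fix n r
  assume "r \<in> MaxSpec (B1_poly n)"
  then obtain h where "h \<in> b1_hom (B1_poly n) B1" "r = b1_kernel (B1_poly n) h"
    unfolding b1_algebra.MaxSpec_eq_b1_kernels[OF b1_algebra_B1_poly] by blast
  then show "b1_isomorphic (b1_quotient (B1_poly n) r) B1"
    using b1_algebra.b1_quotient_b1_kernel_isomorphic[OF b1_algebra_B1_poly] by simp
qed (rule card_MaxSpec_B1_poly)

end
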